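(* Let $\mathcal{A}$ be the set of triples $(a,b,p)\in\mathbb{Z}_{>0}^{3}$ such that $2<p<a<b$, both $p$ and $a$ are prime, $\gcd(a,b)=1$, and $p\nmid b$. There do not exist finitely many polynomials $f_1,\ldots,f_m\in\mathbb{C}[X_1,X_2,X_3]$ with the property that, for every $(a,b,p)\in\mathcal{A}$, at least one index $i\in\{1,\ldots,m\}$ satisfies $$f_i(a,b,p)=g\!\left(\frac{\langle a,b\rangle}{p}\right).$$ In particular, there is no finite family $f_1,\ldots,f_m\in\mathbb{C}[X_1,X_2,X_3]$ such that, for all relatively prime positive integers $a<b$ and all positive integers $p<a$, at least one index $i$ satisfies $f_i(a,b,p)=g\!\left(\frac{\langle a,b\rangle}{p}\right)$.
   Context: $\mathbb{N}$ denotes the non-negative integers and $\mathbb{Z}_{>0}$ the positive integers. A numerical semigroup is a subset $S\subseteq\mathbb{N}$ containing $0$, closed under addition, with $\mathbb{N}\setminus S$ finite. For positive integers $a,b$ with $\gcd(a,b)=1$, $\langle a,b\rangle=\{xa+yb: x,y\in\mathbb{N}\}$, which is a numerical semigroup. For a numerical semigroup $S$ and $p\in\mathbb{Z}_{>0}$, the quotient is $\frac{S}{p}=\{n\in\mathbb{N}: pn\in S\}$, which is again a numerical semigroup, equal to $\mathbb{N}$ if and only if $p\in S$. For a numerical semigroup $S\neq\mathbb{N}$, the Frobenius number is $g(S)=\max(\mathbb{N}\setminus S)$. *)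

theory Defs
  imports
    Complex_Main
    "HOL-Computational_Algebra.Polynomial"
    "HOL-Computational_Algebra.Primes"
    "HOL-Number_Theory.Cong"
begin

definition numerical_semigroup :: "nat set \<Rightarrow> bool" where
  "numerical_semigroup S \<longleftrightarrow>
     0 \<in> S \<and> (\<forall>x\<in>S. \<forall>y\<in>S. x + y \<in> S) \<and> finite (UNIV - S)"

definition sg_gen2 :: "nat \<Rightarrow> nat \<Rightarrow> nat set" where
  "sg_gen2 a b = {x * a + y * b | x y. True}"

definition sg_quotient :: "nat set \<Rightarrow> nat \<Rightarrow> nat set" where
  "sg_quotient S p = {n. p * n \<in> S}"

(* Meaningful only for a numerical semigroup S other than UNIV: then the set below is
   finite and nonempty. *)
definition frobenius_number :: "nat set \<Rightarrow> nat" where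
  "frobenius_number S = Max (UNIV - S)"

lemma numerical_semigroup_sg_gen2:
  assumes "a > 0" and "coprime a b"
  shows "numerical_semigroup (sg_gen2 a b)"
proof -
  have "n \<in> sg_gen2 a b" if n: "n \<ge> a * b" for n
  proof -
    obtain u where u: "[b * u = Suc 0] (mod a)"
      using cong_solve_coprime_nat[of b a] assms(2) by (auto simp: coprime_commute)
    define y where "y = (u * n) mod a"
    have "[b * y = b * (u * n)] (mod a)"
      by (simp add: y_def cong_def mod_mult_right_eq)
    also have "b * (u * n) = (b * u) * n" by simp
    also have "[(b * u) * n = Suc 0 * n] (mod a)"
      using u by (rule cong_scalar_right)
    finally have c: "[n = b * y] (mod a)" by (simp add: cong_sym_eq)
    have "y < a" using assms(1) by (simp add: y_def)
    then have "b * y \<le> n" using n by (metis less_imp_le mult.commute mult_le_mono2 le_trans)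
    then have "a dvd n - b * y" using c by (simp add: cong_altdef_nat)
    then obtain x where "n - b * y = a * x" by blast
    then have "n = x * a + y * b" using \<open>b * y \<le> n\<close> by (simp add: algebra_simps)
    then show ?thesis by (auto simp: sg_gen2_def)
  qed
  then have "UNIV - sg_gen2 a b \<subseteq> {..<a * b}" by (force simp: not_le)
  then have "finite (UNIV - sg_gen2 a b)" by (rule finite_subset) simp
  moreover have "s + t \<in> sg_gen2 a b" if "s \<in> sg_gen2 a b" "t \<in> sg_gen2 a b" for s t
  proof -
    from that obtain x y x' y' where "s = x * a + y * b" "t = x' * a + y' * b"
      by (auto simp: sg_gen2_def)
    then have "s + t = (x + x') * a + (y + y') * b" by (simp add: algebra_simps)
    then show ?thesis unfolding sg_gen2_def by blast
  qed
  moreover have "0 \<in> sg_gen2 a b" by (force simp: sg_gen2_def)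
  ultimately show ?thesis unfolding numerical_semigroup_def by blast
qed

lemma numerical_semigroup_sg_quotient:
  assumes "numerical_semigroup S" and "p > 0"
  shows "numerical_semigroup (sg_quotient S p)"
proof -
  have "(\<lambda>n. p * n) ` (UNIV - sg_quotient S p) \<subseteq> UNIV - S"
    by (auto simp: sg_quotient_def)
  then have "finite ((\<lambda>n. p * n) ` (UNIV - sg_quotient S p))"
    using assms(1) finite_subset unfolding numerical_semigroup_def by blast
  then have "finite (UNIV - sg_quotient S p)"
    using assms(2) by (auto intro: finite_imageD simp: inj_on_def)
  then show ?thesis using assms(1)
    by (auto simp: numerical_semigroup_def sg_quotient_def distrib_left)
qed

lemma sg_quotient_eq_UNIV_iff:
  assumes "numerical_semigroup S"
  shows "sg_quotient S p = UNIV \<longleftrightarrow> p \<in> S"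
proof
  assume "sg_quotient S p = UNIV"
  then have "1 \<in> sg_quotient S p" by simp
  then show "p \<in> S" by (simp add: sg_quotient_def)
next
  assume p: "p \<in> S"
  have "p * n \<in> S" for n
    using assms p by (induction n) (auto simp: numerical_semigroup_def)
  then show "sg_quotient S p = UNIV" by (auto simp: sg_quotient_def)
qed

(* In particular every Frobenius number occurring in the theorem is the maximum of a
   finite nonempty set. *)
lemma sg_quotient_sg_gen2_neq_UNIV:
  assumes "0 < p" "p < a" "a < b" "coprime a b"
  shows "sg_quotient (sg_gen2 a b) p \<noteq> UNIV"
proof -
  have "p \<notin> sg_gen2 a b"
  proof
    assume "p \<in> sg_gen2 a b"
    then obtain x y where p: "p = x * a + y * b" by (auto simp: sg_gen2_def)
    with assms show False by (cases x; cases y) auto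
  qed
  then show ?thesis
    using assms numerical_semigroup_sg_gen2[of a b] by (simp add: sg_quotient_eq_UNIV_iff)
qed

(* C[X1,X2,X3] is the iterated polynomial ring C[X1][X2][X3]: the outermost variable is
   X3, the innermost X1. *)
type_synonym cpoly3 = "complex poly poly poly"

definition eval3 :: "cpoly3 \<Rightarrow> complex \<Rightarrow> complex \<Rightarrow> complex \<Rightarrow> complex" where
  "eval3 f x y z = poly (poly (poly f [:[:z:]:]) [:y:]) x"

lemma eval3_monomial:
  "eval3 (monom (monom (monom c i) j) k) x y z = c * x ^ i * y ^ j * z ^ k"
  by (simp add: eval3_def poly_monom poly_power)

lemma eval3_ring_hom:
  "eval3 (f + g) x y z = eval3 f x y z + eval3 g x y z"
  "eval3 (f * g) x y z = eval3 f x y z * eval3 g x y z"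
  "eval3 1 x y z = 1"
  by (simp_all add: eval3_def)

definition prime_triples :: "(nat \<times> nat \<times> nat) set" where
  "prime_triples =
     {(a, b, p). 2 < p \<and> p < a \<and> a < b \<and> prime p \<and> prime a \<and> coprime a b \<and> \<not> p dvd b}"

end

theory Submission
  imports Defs
begin

text \<open>
  For $b > pa$ the Frobenius number is $(ab - b - ua)/p$, where $u \in \{1,\dots,p\}$ is the
  residue with $ua \equiv (a-1)b \pmod p$. Fix primes $2 < p < a$ with $p$ large and
  $a \not\equiv 1 \pmod p$. Each $u \in \{1,\dots,p-1\}$ then occurs for infinitely many $b$, on
  which a single $f_i$ must be correct, so that $f_i(a,Y,p) = ((a-1)Y - ua)/p$. These polynomials
  are distinct, so $p - 1$ of them are needed.
\<close>

lemma frobenius_number_eqI: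
  assumes "n \<notin> S" and "\<And>k. n < k \<Longrightarrow> k \<in> S"
  shows "frobenius_number S = n"
  unfolding frobenius_number_def
proof (rule Max_eqI)
  have "UNIV - S \<subseteq> {..n}" using assms(2) by (force simp: not_less)
  then show "finite (UNIV - S)" by (rule finite_subset) simp
qed (use assms in \<open>force simp: not_less\<close>)+

text \<open>Each \<open>p * k\<close> outside the semigroup can be written as
  \<open>y * b - x * a\<close> with \<open>y < a\<close> and \<open>x > 0\<close>. As
  \<open>b\<close> exceeds \<open>p * a\<close>, only \<open>y = a - 1\<close> can occur for
  \<open>k > n\<close>. Since \<open>a\<close> is invertible modulo \<open>p\<close>, the multiples
  of \<open>p\<close> of the form \<open>a * b - b - x * a\<close> are those with \<open>x\<close>
  congruent to \<open>u\<close>, and \<open>u\<close> is the least positive such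
  \<open>x\<close>.\<close>

lemma frobenius_number_sg_quotient_large:
  fixes a b p n u :: nat
  assumes ab: "coprime a b" and pa: "coprime a p" and p: "0 < p" and a: "0 < a"
    and big: "p * a < b" and u: "0 < u" "u \<le> p" and n: "p * n + b + u * a = a * b"
  shows "frobenius_number (sg_quotient (sg_gen2 a b) p) = n"
proof (rule frobenius_number_eqI)
  show "n \<notin> sg_quotient (sg_gen2 a b) p"
  proof
    assume "n \<in> sg_quotient (sg_gen2 a b) p"
    then obtain x y where xy: "p * n = x * a + y * b"
      by (auto simp: sg_quotient_def sg_gen2_def)
    have eq: "(y + 1) * b + (x + u) * a = a * b"
      using n xy by (simp add: algebra_simps)
    then have "a dvd (y + 1) * b"
      by (metis dvd_add_left_iff dvd_triv_left dvd_triv_right)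
    then have "a dvd y + 1" using ab coprime_dvd_mult_left_iff by blast
    then have "a * b \<le> (y + 1) * b" by (intro mult_le_mono1) (simp add: dvd_imp_le)
    then have "(x + u) * a = 0" using eq by linarith
    then show False using u a by simp
  qed
next
  fix k assume k: "n < k"
  obtain v where v: "[b * v = 1] (mod a)"
    using cong_solve_coprime_nat[of b a] ab by (auto simp: coprime_commute)
  \<comment> \<open>The coefficient of \<open>b\<close> reduced modulo \<open>a\<close>, so that
    \<open>p * k\<close> and \<open>y * b\<close> differ by a multiple of \<open>a\<close>. The sign
    of the difference decides the case below.\<close>
  define y where "y = (v * (p * k)) mod a"
  have ya: "y < a" using a by (simp add: y_def)
  have "[b * y = b * (v * (p * k))] (mod a)"
    by (simp add: y_def cong_def mod_mult_right_eq)
  also have "b * (v * (p * k)) = (b * v) * (p * k)" by simp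
  also have "[(b * v) * (p * k) = 1 * (p * k)] (mod a)" using v by (rule cong_scalar_right)
  finally have c: "[b * y = p * k] (mod a)" by simp
  show "k \<in> sg_quotient (sg_gen2 a b) p"
  proof (cases "b * y \<le> p * k")
    case True
    then have "a dvd p * k - b * y" using cong_sym[OF c] True by (simp add: cong_altdef_nat)
    then obtain x where "p * k - b * y = a * x" by blast
    then have "p * k = x * a + y * b" using True by (simp add: algebra_simps)
    then show ?thesis by (auto simp: sg_quotient_def sg_gen2_def)
  next
    case False
    then have "a dvd b * y - p * k" using c by (simp add: cong_altdef_nat)
    then obtain x where "b * y - p * k = a * x" by blast
    then have x: "p * k + x * a = y * b" using False by (simp add: algebra_simps)
    have pk: "p * n < p * k" using k p by simp
    show ?thesis
    proof (cases "y + 1 = a")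
      case True
      then have "a * b = y * b + b" by (metis add_mult_distrib mult_1)
      then have eq: "p * k + x * a = p * n + u * a" using x n by linarith
      then have "x * a < u * a" using pk by linarith
      then have xu: "x < u" by simp
      have "p * (k - n) = (u - x) * a"
        using eq k xu by (simp add: diff_mult_distrib diff_mult_distrib2)
      \<comment> \<open>Here \<open>u - x\<close> is a positive multiple of \<open>p\<close> but at
        most \<open>u \<le> p\<close>, which leaves only \<open>x = 0\<close>. Then
        \<open>p * k = y * b\<close>, against the case assumption.\<close>
      then have "p dvd (u - x) * a" by (metis dvd_triv_left)
      then have "p dvd u - x"
        using pa by (simp add: coprime_commute coprime_dvd_mult_left_iff)
      then have "p \<le> u - x" using xu by (simp add: dvd_imp_le)
      then have "x = 0" using u by simp
      then show ?thesis using x \<open>\<not> b * y \<le> p * k\<close> by (simp add: mult.commute)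
    next
      case False
      \<comment> \<open>Now \<open>p * k \<le> (a - 2) * b\<close>, whereas
        \<open>p * n \<ge> a * b - b - p * a > (a - 2) * b\<close>.\<close>
      then have "y + 2 \<le> a" using ya by simp
      then have "(y + 2) * b \<le> a * b" by (rule mult_le_mono1)
      then have "y * b + 2 * b \<le> a * b" by (simp add: algebra_simps)
      moreover have "u * a \<le> p * a" using u by simp
      ultimately have False using n x pk big by linarith
      then show ?thesis ..
    qed
  qed
qed

text \<open>For fixed \<open>a\<close> and \<open>p\<close> each candidate becomes a polynomial in
  \<open>b\<close> alone, so its values at infinitely many \<open>b\<close> determine it.\<close>

lemma eval3_poly_middle: "\<exists>q. \<forall>y. eval3 f x y z = poly q y"
proof -
  have "\<exists>q. \<forall>y. poly (poly F [:y:]) x = poly q y" for F :: "complex poly poly"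
  proof (induction F)
    case 0
    then show ?case by (intro exI[of _ 0]) simp
  next
    case (pCons c F)
    then obtain q where "\<forall>y. poly (poly F [:y:]) x = poly q y" by blast
    then show ?case by (intro exI[of _ "pCons (poly c x) q"]) simp
  qed
  then show ?thesis by (simp add: eval3_def)
qed

lemma poly_eqI_infinite:
  fixes q r :: "'a :: idom poly"
  assumes "infinite X" and "\<And>x. x \<in> X \<Longrightarrow> poly q x = poly r x"
  shows "q = r"
proof (rule ccontr)
  assume "q \<noteq> r"
  then have "finite {x. poly (q - r) x = 0}" by (intro poly_roots_finite) simp
  moreover have "X \<subseteq> {x. poly (q - r) x = 0}" using assms(2) by auto
  ultimately show False using assms(1) finite_subset by blast
qed

text \<open>All prime factors of \<open>p! - 1\<close> exceed \<open>p\<close>. If all were 1 modulo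
  \<open>p\<close>, so would be their product, which is however -1 modulo \<open>p\<close>; then
  \<open>p\<close> would divide 2. The lemma makes \<open>a - 1\<close> invertible modulo
  \<open>p\<close>, so that every residue \<open>u\<close> can be realised.\<close>

lemma exists_prime_gt_not_cong_1:
  fixes p :: nat
  assumes "prime p" "2 < p"
  shows "\<exists>a. prime a \<and> p < a \<and> \<not> [a = 1] (mod p)"
proof (rule ccontr)
  assume contra: "\<not> ?thesis"
  define N :: nat where "N = fact p - 1"
  have N: "N + 1 = fact p" by (simp add: N_def)
  have "fact p \<ge> p" by (rule fact_ge_self)
  then have "N \<noteq> 0" using assms N by linarith
  have "[q = 1] (mod p)" if "q \<in> prime_factors N" for q
  proof -
    have q: "prime q" "q dvd N" using that by auto
    have "p < q"
    proof (rule ccontr)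
      assume "\<not> p < q"
      then have "q dvd fact p" using q by (simp add: prime_dvd_fact_iff)
      then have "q dvd 1" using q N by (metis dvd_add_right_iff)
      then show False using q by simp
    qed
    then show ?thesis using contra q by blast
  qed
  then have "[(\<Prod>q\<in>prime_factors N. q ^ multiplicity q N) = (\<Prod>q\<in>prime_factors N. 1)] (mod p)"
    by (intro cong_prod) (metis cong_pow power_one)
  then have "[N = 1] (mod p)"
    using \<open>N \<noteq> 0\<close> prime_factorization_nat[of N] by simp
  then have "[N + 1 = 1 + 1] (mod p)" by (rule cong_add) simp
  moreover have "[N + 1 = 0] (mod p)"
    unfolding N cong_0_iff using assms by (simp add: prime_dvd_fact_iff)
  ultimately have "[2 = 0] (mod p)" by (metis cong_sym cong_trans one_add_one)
  then show False using assms by (auto simp: cong_0_iff dest: dvd_imp_le)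
qed

lemma infinite_large_b_with_residue:
  fixes a p u :: nat
  assumes p: "prime p" "2 < p" and a: "prime a" "p < a" "\<not> [a = 1] (mod p)"
    and u: "0 < u" "u < p"
  shows "infinite {b. (a, b, p) \<in> prime_triples \<and>
    a * b = p * frobenius_number (sg_quotient (sg_gen2 a b) p) + b + u * a}"
    (is "infinite ?B")
proof -
  have ap: "coprime a p" using p a by (simp add: primes_coprime)
  have "\<not> p dvd a - 1"
    using a by (simp add: cong_altdef_nat)
  then have "coprime (a - 1) p"
    using p(1) by (metis coprime_commute prime_imp_coprime)
  then obtain w where w: "[(a - 1) * w = 1] (mod p)"
    using cong_solve_coprime_nat by (metis One_nat_def)
  \<comment> \<open>The residue 1 modulo \<open>a\<close> gives coprimality. The residue modulo
    \<open>p\<close> solves \<open>(a - 1) * b = u * a\<close>, which makes \<open>n\<close> an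
    integer.\<close>
  obtain x where x: "[x = 1] (mod a)" "[x = w * (u * a)] (mod p)"
    using binary_chinese_remainder_nat[OF ap] by blast
  \<comment> \<open>The shift \<open>k + 1\<close>, together with \<open>x > 0\<close>, puts even
    \<open>B 0\<close> above \<open>p * a\<close>.\<close>
  define B where "B k = x + a * p * (k + 1)" for k
  have "B k \<in> ?B" for k
  proof -
    have "[x + a * p * (k + 1) = 1 + 0] (mod a)"
      by (intro cong_add x(1)) (simp add: cong_0_iff mult.assoc)
    then have Ba: "[B k = 1] (mod a)" by (simp add: B_def)
    have "[x + a * p * (k + 1) = x + 0] (mod p)"
      by (intro cong_add cong_refl) (simp add: cong_0_iff mult.assoc)
    then have "[B k = x] (mod p)" by (simp add: B_def)
    then have Bp: "[B k = w * (u * a)] (mod p)" using x(2) by (rule cong_trans)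
    then have "[(a - 1) * B k = (a - 1) * (w * (u * a))] (mod p)" by (rule cong_scalar_left)
    also have "(a - 1) * (w * (u * a)) = ((a - 1) * w) * (u * a)" by simp
    also have "[((a - 1) * w) * (u * a) = 1 * (u * a)] (mod p)" using w by (rule cong_scalar_right)
    finally have c: "[(a - 1) * B k = u * a] (mod p)" by simp
    have "\<not> p dvd u * a"
      using u p a ap by (auto simp: coprime_commute coprime_dvd_mult_left_iff dest: dvd_imp_le)
    then have pB: "\<not> p dvd B k"
      using c by (metis cong_dvd_iff dvd_mult)
    have cop: "coprime a (B k)"
      using Ba by (metis cong_imp_coprime cong_sym coprime_1_left coprime_commute)
    have x0: "0 < x"
      using x(1) a(1) by (intro gr0I) (auto simp: cong_def dest: prime_gt_1_nat)
    then have big: "p * a < B k" by (simp add: B_def algebra_simps)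
    \<comment> \<open>These estimates give \<open>a < B k\<close> and ensure that the natural-number
      subtraction \<open>(a - 1) * B k - u * a\<close> does not truncate.\<close>
    have "1 * a \<le> p * a" using p by (intro mult_le_mono1) simp
    then have "a < B k" using big by linarith
    have "u * a \<le> p * a" using u by simp
    also have "p * a \<le> 1 * B k" using big by simp
    also have "\<dots> \<le> (a - 1) * B k" using p a by (intro mult_le_mono1) linarith
    finally have le: "u * a \<le> (a - 1) * B k" .
    then have "p dvd (a - 1) * B k - u * a" using c by (simp add: cong_altdef_nat)
    then obtain n where "(a - 1) * B k - u * a = p * n" by blast
    then have "(a - 1) * B k = p * n + u * a" using le by simp
    moreover have "a * B k = (a - 1) * B k + B k"
      using p a by (cases a) auto
    ultimately have n: "p * n + B k + u * a = a * B k" by simp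
    have "frobenius_number (sg_quotient (sg_gen2 a (B k)) p) = n"
      using frobenius_number_sg_quotient_large[OF cop ap _ _ big _ _ n] p a u by simp
    then show ?thesis
      using n p a cop pB \<open>a < B k\<close> by (simp add: prime_triples_def)
  qed
  then have "range B \<subseteq> ?B" by blast
  moreover have "infinite (range B)"
    using p a by (intro range_inj_infinite) (simp add: B_def inj_def)
  ultimately show ?thesis by (rule infinite_super)
qed

lemma no_finite_polynomial_family:
  fixes f :: "nat \<Rightarrow> cpoly3" and I :: "nat set"
  assumes "finite I"
    and f: "\<And>a b p. (a, b, p) \<in> prime_triples \<Longrightarrow> \<exists>i\<in>I.
      eval3 (f i) (of_nat a) (of_nat b) (of_nat p)
        = of_nat (frobenius_number (sg_quotient (sg_gen2 a b) p))"
  shows False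
proof -
  \<comment> \<open>The bound gives both \<open>2 < p\<close> and more nonzero residues modulo
    \<open>p\<close> than indices in \<open>I\<close>.\<close>
  obtain p :: nat where p: "prime p" "card I + 2 < p" using bigger_prime by blast
  then obtain a where a: "prime a" "p < a" "\<not> [a = 1] (mod p)"
    using exists_prime_gt_not_cong_1[of p] by auto
  define g where "g b = frobenius_number (sg_quotient (sg_gen2 a b) p)" for b
  define L :: "nat \<Rightarrow> complex poly" where
    "L u = [:- (of_nat u * of_nat a / of_nat p), (of_nat a - 1) / of_nat p:]" for u
  have "\<exists>i\<in>I. \<forall>y. eval3 (f i) (of_nat a) y (of_nat p) = poly (L u) y"
    if u: "u \<in> {1..<p}" for u
  proof -
    define B where "B = {b. (a, b, p) \<in> prime_triples \<and> a * b = p * g b + b + u * a}"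
    have "infinite B"
      unfolding B_def g_def using infinite_large_b_with_residue[of p a u] p a u by simp
    moreover have "\<forall>b\<in>B. \<exists>i\<in>I.
        eval3 (f i) (of_nat a) (of_nat b) (of_nat p) = of_nat (g b)"
      unfolding B_def g_def using f by blast
    \<comment> \<open>Finitely many indices cover the infinite set \<open>B\<close>, so one of them
      is correct infinitely often.\<close>
    ultimately have "\<exists>i\<in>I. infinite {b\<in>B.
        eval3 (f i) (of_nat a) (of_nat b) (of_nat p) = of_nat (g b)}"
      by (rule pigeonhole_infinite_rel[OF _ assms(1)])
    then obtain i where i: "i \<in> I" "infinite {b\<in>B.
        eval3 (f i) (of_nat a) (of_nat b) (of_nat p) = of_nat (g b)}" (is "infinite ?X") ..
    obtain q where q: "\<And>y. eval3 (f i) (of_nat a) y (of_nat p) = poly q y"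
      using eval3_poly_middle by blast
    have "q = L u"
    proof (rule poly_eqI_infinite)
      show "infinite (of_nat ` ?X :: complex set)"
        using i(2) by (simp add: finite_image_iff inj_on_def)
    next
      fix x :: complex assume "x \<in> of_nat ` ?X"
      then obtain b where b: "b \<in> B" "x = of_nat b" "poly q x = of_nat (g b)"
        using q by auto
      have "a * b = p * g b + b + u * a" using b(1) by (simp add: B_def)
      then have "(of_nat (a * b) :: complex) = of_nat (p * g b + b + u * a)" by simp
      then have "(of_nat (g b) :: complex) = poly (L u) (of_nat b)"
        using p by (simp add: L_def field_simps)
      then show "poly q x = poly (L u) x" using b by simp
    qed
    then show ?thesis using i(1) q by auto
  qed
  then have "\<forall>u\<in>{1..<p}. \<exists>i. i \<in> I \<and>
      (\<forall>y. eval3 (f i) (of_nat a) y (of_nat p) = poly (L u) y)" by blast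
  then obtain h where "\<forall>u\<in>{1..<p}. h u \<in> I \<and>
      (\<forall>y. eval3 (f (h u)) (of_nat a) y (of_nat p) = poly (L u) y)"
    by (rule bchoice[THEN exE])
  then have h: "\<And>u. u \<in> {1..<p} \<Longrightarrow> h u \<in> I"
    "\<And>u y. u \<in> {1..<p} \<Longrightarrow> eval3 (f (h u)) (of_nat a) y (of_nat p) = poly (L u) y"
    by blast+
  \<comment> \<open>The constant term \<open>- u * a / p\<close> of \<open>L u\<close> recovers
    \<open>u\<close>, so one index cannot serve two residues.\<close>
  have "inj_on h {1..<p}"
  proof (rule inj_onI)
    fix u v assume "u \<in> {1..<p}" "v \<in> {1..<p}" "h u = h v"
    then have "poly (L u) 0 = poly (L v) 0" using h(2)[of u 0] h(2)[of v 0] by simp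
    then show "u = v" using p a by (simp add: L_def)
  qed
  then have "card {1..<p} \<le> card I" using h(1) assms(1) by (intro card_inj_on_le) auto
  then show False using p by simp
qed

theorem corollary1p3:
  shows "(\<nexists>(m :: nat) (f :: nat \<Rightarrow> cpoly3).
            \<forall>(a, b, p) \<in> prime_triples. \<exists>i\<in>{1..m}.
              eval3 (f i) (of_nat a) (of_nat b) (of_nat p)
                = of_nat (frobenius_number (sg_quotient (sg_gen2 a b) p)))
       \<and> (\<nexists>(m :: nat) (f :: nat \<Rightarrow> cpoly3).
            \<forall>a b p :: nat. 0 < a \<and> a < b \<and> coprime a b \<and> 0 < p \<and> p < a \<longrightarrow>
              (\<exists>i\<in>{1..m}.
                eval3 (f i) (of_nat a) (of_nat b) (of_nat p)
                  = of_nat (frobenius_number (sg_quotient (sg_gen2 a b) p))))"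
proof (intro conjI notI; elim exE)
  fix m :: nat and f :: "nat \<Rightarrow> cpoly3"
  assume "\<forall>(a, b, p) \<in> prime_triples. \<exists>i\<in>{1..m}.
    eval3 (f i) (of_nat a) (of_nat b) (of_nat p)
      = of_nat (frobenius_number (sg_quotient (sg_gen2 a b) p))"
  then show False by (intro no_finite_polynomial_family[of "{1..m}" f]) auto
next
  fix m :: nat and f :: "nat \<Rightarrow> cpoly3"
  assume *: "\<forall>a b p :: nat. 0 < a \<and> a < b \<and> coprime a b \<and> 0 < p \<and> p < a \<longrightarrow>
    (\<exists>i\<in>{1..m}. eval3 (f i) (of_nat a) (of_nat b) (of_nat p)
      = of_nat (frobenius_number (sg_quotient (sg_gen2 a b) p)))"
  \<comment> \<open>A family for all coprime pairs would in particular serve the prime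
    triples.\<close>
  show False
  proof (rule no_finite_polynomial_family[of "{1..m}" f])
    fix a b p assume "(a, b, p) \<in> prime_triples"
    then have "0 < a \<and> a < b \<and> coprime a b \<and> 0 < p \<and> p < a" by (auto simp: prime_triples_def)
    then show "\<exists>i\<in>{1..m}. eval3 (f i) (of_nat a) (of_nat b) (of_nat p)
        = of_nat (frobenius_number (sg_quotient (sg_gen2 a b) p))" using * by blast
  qed simp
qed

end
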